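(* Let $n \ge 1$, let $B \subset \mathbb{R}^{n+1}$ be a compact strictly-convex set with non-empty interior, let $S = \partial B$, and let $v \in \mathbb{R}^{n+1}$ be a non-zero vector. Then the set $$\mathcal{M}_v = \left\{ \frac{x^+ + x^-}{2} : x^+ \in D_v^+,\ x^- \in D_v^-,\ p_v(x^+) = p_v(x^-) \right\}$$ is homeomorphic to the closed disc $\mathbb{D}^n$, and $\mathcal{M}_v \cap S$ is homeomorphic to $S^{n-1}$.
   Context: A subset $B \subset \mathbb{R}^{n+1}$ is strictly-convex if for all $x, y \in B$ every point of the straight line segment from $x$ to $y$, except possibly $x$ and $y$ themselves, lies in the interior of $B$. $p_v$ denotes the orthogonal projection of $\mathbb{R}^{n+1}$ onto the hyperplane $v^\perp \cong \mathbb{R}^n$; the interior and boundary of $p_v(B)$ are taken in $v^\perp$. $D_v^0 = \{x \in B : p_v(x) \in \partial p_v(B)\}$. For each $x$ in the interior of $p_v(B)$ there are exactly two points of $S$ projecting to $x$ under $p_v$; denote by $x^+$ the one with the larger value of $u \mapsto u \cdot v$ and by $x^-$ the one with the smaller value. Put $U_v^{+} = \{x^{+} : x \in \operatorname{Int} p_v(B)\}$, $U_v^{-} = \{x^{-} : x \in \operatorname{Int} p_v(B)\}$ and $D_v^{\pm} = D_v^0 \cup U_v^{\pm}$. *)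

theory Defs
  imports "HOL-Analysis.Analysis"
begin

text \<open>\<open>open_segment x y\<close> is the closed segment without its two endpoints.\<close>

definition strictly_convex :: "'a::euclidean_space set \<Rightarrow> bool" where
  "strictly_convex B \<longleftrightarrow> (\<forall>x\<in>B. \<forall>y\<in>B. open_segment x y \<subseteq> interior B)"

definition perp :: "'a::euclidean_space \<Rightarrow> 'a set" where
  "perp v = {x. v \<bullet> x = 0}"

definition orth_proj :: "'a::euclidean_space \<Rightarrow> 'a \<Rightarrow> 'a" where
  "orth_proj v x = x - ((x \<bullet> v) / (v \<bullet> v)) *\<^sub>R v"

text \<open>Interior and boundary of the shadow of \<open>B\<close> are taken in the hyperplane \<open>perp v\<close>, not in
  the ambient space.\<close>

definition shadow_interior :: "'a::euclidean_space set \<Rightarrow> 'a \<Rightarrow> 'a set" where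
  "shadow_interior B v = top_of_set (perp v) interior_of (orth_proj v ` B)"

definition shadow_boundary :: "'a::euclidean_space set \<Rightarrow> 'a \<Rightarrow> 'a set" where
  "shadow_boundary B v = top_of_set (perp v) frontier_of (orth_proj v ` B)"

definition D_zero :: "'a::euclidean_space set \<Rightarrow> 'a \<Rightarrow> 'a set" where
  "D_zero B v = {x \<in> B. orth_proj v x \<in> shadow_boundary B v}"

text \<open>For compact strictly convex \<open>B\<close> with non-empty interior, \<open>v \<noteq> 0\<close> and
  \<open>x \<in> shadow_interior B v\<close>, exactly two points of \<open>frontier B\<close> project to \<open>x\<close>; \<open>upper_point\<close> and
  \<open>lower_point\<close> are the ones with the larger and the smaller value of \<open>u \<mapsto> u \<bullet> v\<close>. A point is
  determined by its projection and that value, so the maximiser and minimiser are unique.\<close>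

definition upper_point :: "'a::euclidean_space set \<Rightarrow> 'a \<Rightarrow> 'a \<Rightarrow> 'a" where
  "upper_point B v x = (ARG_MAX (\<lambda>u. u \<bullet> v) u. u \<in> frontier B \<and> orth_proj v u = x)"

definition lower_point :: "'a::euclidean_space set \<Rightarrow> 'a \<Rightarrow> 'a \<Rightarrow> 'a" where
  "lower_point B v x = (ARG_MIN (\<lambda>u. u \<bullet> v) u. u \<in> frontier B \<and> orth_proj v u = x)"

definition D_plus :: "'a::euclidean_space set \<Rightarrow> 'a \<Rightarrow> 'a set" where
  "D_plus B v = D_zero B v \<union> upper_point B v ` shadow_interior B v"

definition D_minus :: "'a::euclidean_space set \<Rightarrow> 'a \<Rightarrow> 'a set" where
  "D_minus B v = D_zero B v \<union> lower_point B v ` shadow_interior B v"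

definition midpoint_set :: "'a::euclidean_space set \<Rightarrow> 'a \<Rightarrow> 'a set" where
  "midpoint_set B v =
     {midpoint a b | a b. a \<in> D_plus B v \<and> b \<in> D_minus B v \<and> orth_proj v a = orth_proj v b}"

end

theory Submission imports Defs begin

text \<open>
  Write \<open>p\<close> for the orthogonal projection along \<open>v\<close> and \<open>P\<close> for the shadow \<open>p ` B\<close>. The shadow is a
  compact convex body in the hyperplane \<open>perp v\<close>, so it is homeomorphic to the disc of the dimension
  of that hyperplane, and its relative frontier to the bounding sphere. It is therefore enough
  that \<open>p\<close> maps the midpoint set homeomorphically onto \<open>P\<close>, and its part on \<open>frontier B\<close> onto the
  relative frontier of \<open>P\<close>.

  The sets \<open>D_plus\<close> and \<open>D_minus\<close> consist of the highest and lowest points of the fibres of \<open>p\<close>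
  on \<open>B\<close> (\<open>D_plus_eq_upper_graph\<close>): over the interior of the shadow this is how they are defined,
  and over the boundary the fibre is a single point, because a nontrivial segment in \<open>B\<close> meets \<open>interior B\<close>,
  whose projection is the interior of the shadow. Hence every fibre has exactly one
  midpoint, and \<open>p\<close> is a continuous bijection from the midpoint set onto \<open>P\<close>.

  Continuity of the inverse comes from compactness of the midpoint set, which reduces to
  closedness of the set of highest points. A point \<open>a\<close> of \<open>B\<close> fails to be highest exactly when
  some \<open>a + s *\<^sub>R v\<close> with \<open>s > 0\<close> lies in \<open>interior B\<close>: strict convexity puts the
  midpoint of \<open>a\<close> and a higher point of its fibre in the interior. This is an open condition on \<open>a\<close>
  (\<open>upper_graph_eq\<close>).

  Finally, a midpoint lies on \<open>frontier B\<close> exactly when its fibre is a single point, and that happens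
  exactly over the boundary of the shadow (\<open>midpoint_in_frontier_iff\<close>).
\<close>

section \<open>The projection and the shadow\<close>

lemma linear_orth_proj: "linear (orth_proj v)"
  unfolding orth_proj_def
  by (rule linearI) (simp_all add: algebra_simps inner_add_left add_divide_distrib)

lemma continuous_on_orth_proj: "continuous_on S (orth_proj v)"
  by (rule linear_continuous_on) (simp add: linear_orth_proj linear_conv_bounded_linear[symmetric])

lemma orth_proj_uminus: "orth_proj (- v) = orth_proj v"
  by (rule ext) (simp add: orth_proj_def)

lemma orth_proj_add_scaleR: "v \<noteq> 0 \<Longrightarrow> orth_proj v (a + s *\<^sub>R v) = orth_proj v a"
  by (simp add: orth_proj_def algebra_simps inner_add_left add_divide_distrib)

lemma orth_proj_midpoint:
  "orth_proj v a = orth_proj v b \<Longrightarrow> orth_proj v (midpoint a b) = orth_proj v a"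
  unfolding midpoint_def
  by (simp add: linear_orth_proj linear_add linear_cmul flip: scaleR_add_left)

lemma orth_proj_eq_imp_translate:
  "orth_proj v b = orth_proj v a \<Longrightarrow> b = a + ((b \<bullet> v - a \<bullet> v) / (v \<bullet> v)) *\<^sub>R v"
  by (simp add: orth_proj_def algebra_simps diff_divide_distrib)

lemma orth_proj_inner_inject:
  "orth_proj v a = orth_proj v b \<Longrightarrow> a \<bullet> v = b \<bullet> v \<Longrightarrow> a = b"
  by (simp add: orth_proj_def)

lemma range_orth_proj:
  assumes "v \<noteq> 0"
  shows "range (orth_proj v) = perp v"
proof
  show "range (orth_proj v) \<subseteq> perp v"
    using assms by (auto simp: orth_proj_def perp_def inner_diff_right inner_commute)
  show "perp v \<subseteq> range (orth_proj v)"
  proof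
    fix x assume "x \<in> perp v"
    then have "x = orth_proj v x"
      by (simp add: orth_proj_def perp_def inner_commute)
    then show "x \<in> range (orth_proj v)" by blast
  qed
qed

lemma strictly_convex_imp_convex:
  assumes "strictly_convex B"
  shows "convex B"
  unfolding convex_contains_segment
proof (intro ballI)
  fix a b assume "a \<in> B" "b \<in> B"
  then show "closed_segment a b \<subseteq> B"
    using assms interior_subset[of B]
    unfolding strictly_convex_def closed_segment_eq_open by blast
qed

lemma strictly_convex_midpoint:
  assumes "strictly_convex B" "a \<in> B" "b \<in> B" "a \<noteq> b"
  shows "midpoint a b \<in> interior B"
  using assms unfolding strictly_convex_def
  by (meson midpoint_in_open_segment subsetD)

lemma affine_hull_shadow:
  assumes "interior B \<noteq> {}" "v \<noteq> 0"
  shows "affine hull (orth_proj v ` B) = perp v"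
  using affine_hull_linear_image[OF linear_orth_proj[unfolded linear_conv_bounded_linear], of v B]
  by (simp add: affine_hull_nonempty_interior range_orth_proj assms)

lemma shadow_interior_eq_rel_interior:
  assumes "interior B \<noteq> {}" "v \<noteq> 0"
  shows "shadow_interior B v = rel_interior (orth_proj v ` B)"
  unfolding shadow_interior_def rel_interior_def affine_hull_shadow[OF assms] interior_of_def
  by auto

lemma shadow_interior_eq_image_interior:
  assumes "strictly_convex B" "interior B \<noteq> {}" "v \<noteq> 0"
  shows "shadow_interior B v = orth_proj v ` interior B"
  using rel_interior_convex_linear_image[OF linear_orth_proj strictly_convex_imp_convex[OF assms(1)],
      of v]
  by (simp add: shadow_interior_eq_rel_interior rel_interior_nonempty_interior assms)

lemma shadow_boundary_eq_rel_frontier: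
  assumes "compact B" "interior B \<noteq> {}" "v \<noteq> 0"
  shows "shadow_boundary B v = rel_frontier (orth_proj v ` B)"
proof -
  have "closed (orth_proj v ` B)"
    by (intro compact_imp_closed compact_continuous_image continuous_on_orth_proj assms)
  moreover have "orth_proj v ` B \<subseteq> perp v"
    using range_orth_proj[OF assms(3)] by blast
  ultimately have "top_of_set (perp v) closure_of (orth_proj v ` B) = orth_proj v ` B"
    by (simp add: closure_of_closedin closed_subset)
  then show ?thesis
    using shadow_interior_eq_rel_interior[OF assms(2,3)] \<open>closed _\<close>
    by (simp add: shadow_boundary_def shadow_interior_def frontier_of_def rel_frontier_def)
qed

lemma shadow_eq_interior_Un_boundary:
  assumes "compact B" "interior B \<noteq> {}" "v \<noteq> 0"
  shows "orth_proj v ` B = shadow_interior B v \<union> shadow_boundary B v"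
    and "shadow_interior B v \<inter> shadow_boundary B v = {}"
proof -
  have "closed (orth_proj v ` B)"
    by (intro compact_imp_closed compact_continuous_image continuous_on_orth_proj assms)
  then show "orth_proj v ` B = shadow_interior B v \<union> shadow_boundary B v"
    and "shadow_interior B v \<inter> shadow_boundary B v = {}"
    using rel_interior_subset[of "orth_proj v ` B"]
    by (auto simp: shadow_interior_eq_rel_interior shadow_boundary_eq_rel_frontier assms
        rel_frontier_def)
qed

section \<open>Highest points of the fibres\<close>

definition upper_graph :: "'a::euclidean_space set \<Rightarrow> 'a \<Rightarrow> 'a set" where
  "upper_graph B v = {a \<in> B. \<forall>b\<in>B. orth_proj v b = orth_proj v a \<longrightarrow> b \<bullet> v \<le> a \<bullet> v}"

lemma upper_graph_unique:
  "a \<in> upper_graph B v \<Longrightarrow> b \<in> upper_graph B v \<Longrightarrow> orth_proj v a = orth_proj v b \<Longrightarrow> a = b"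
  by (rule orth_proj_inner_inject[of v]) (auto simp: upper_graph_def intro: order_antisym)

lemma upper_graph_exists:
  assumes "compact B" "x \<in> orth_proj v ` B"
  obtains a where "a \<in> upper_graph B v" "orth_proj v a = x"
proof -
  let ?F = "B \<inter> orth_proj v -` {x}"
  have "closed (orth_proj v -` {x})"
    by (intro closed_vimage closed_singleton continuous_on_orth_proj)
  with assms(1) have "compact ?F" by (rule compact_Int_closed)
  moreover have "?F \<noteq> {}" using assms(2) by auto
  ultimately obtain a where "a \<in> ?F" "\<And>b. b \<in> ?F \<Longrightarrow> b \<bullet> v \<le> a \<bullet> v"
    using continuous_attains_sup[of ?F "\<lambda>u. u \<bullet> v"]
    by (force intro!: continuous_intros)
  then show thesis by (intro that[of a]) (auto simp: upper_graph_def)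
qed

text \<open>The midpoint of \<open>a\<close> and a higher point of its fibre is interior, by strict convexity. This
  turns maximality in the fibre, a condition that involves points far from \<open>a\<close>, into one that is
  visibly closed in \<open>a\<close>.\<close>

lemma upper_graph_eq:
  assumes "strictly_convex B" "v \<noteq> 0"
  shows "upper_graph B v = B - (\<Union>s\<in>{0<..}. {a. a + s *\<^sub>R v \<in> interior B})"
proof -
  have "a \<notin> upper_graph B v" if "0 < s" "a + s *\<^sub>R v \<in> interior B" for a s
  proof -
    have "a \<bullet> v < (a + s *\<^sub>R v) \<bullet> v"
      using assms(2) that(1) by (simp add: inner_add_left)
    then show ?thesis
      using that interior_subset[of B] orth_proj_add_scaleR[OF assms(2), of a s]
      by (force simp: upper_graph_def)
  qed
  moreover have "\<exists>s>0. a + s *\<^sub>R v \<in> interior B" if a: "a \<in> B" "a \<notin> upper_graph B v" for a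
  proof -
    from a obtain b where b: "b \<in> B" "orth_proj v b = orth_proj v a" "b \<bullet> v > a \<bullet> v"
      by (auto simp: upper_graph_def not_le)
    define r where "r = (b \<bullet> v - a \<bullet> v) / (v \<bullet> v)"
    have r: "b = a + r *\<^sub>R v" unfolding r_def using b(2) by (rule orth_proj_eq_imp_translate)
    have "r > 0" using b(3) assms(2) by (simp add: r_def)
    have "midpoint a b \<in> interior B"
      using b a(1) assms(1) by (intro strictly_convex_midpoint) auto
    moreover have "midpoint a b = a + (r / 2) *\<^sub>R v"
      unfolding r midpoint_def by (simp add: algebra_simps flip: scaleR_add_left)
    ultimately show ?thesis using \<open>r > 0\<close> by (metis half_gt_zero)
  qed
  moreover have "upper_graph B v \<subseteq> B" by (auto simp: upper_graph_def)
  ultimately show ?thesis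
    unfolding set_eq_iff Diff_iff UN_iff Bex_def mem_Collect_eq greaterThan_iff by blast
qed

lemma compact_upper_graph:
  assumes "compact B" "strictly_convex B" "v \<noteq> 0"
  shows "compact (upper_graph B v)"
proof -
  have "open {a. a + s *\<^sub>R v \<in> interior B}" for s
    using open_vimage[OF open_interior, of "\<lambda>a. a + s *\<^sub>R v" B]
    by (simp add: vimage_def continuous_intros)
  then show ?thesis
    unfolding upper_graph_eq[OF assms(2,3)] using assms(1) by (intro compact_diff open_UN) auto
qed

lemma upper_graph_subset_frontier:
  assumes "compact B" "v \<noteq> 0"
  shows "upper_graph B v \<subseteq> frontier B"
proof
  fix a assume a: "a \<in> upper_graph B v"
  have "a \<notin> interior B"
  proof
    assume "a \<in> interior B"
    then obtain e where e: "e > 0" "cball a e \<subseteq> B" unfolding mem_interior_cball by blast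
    let ?b = "a + (e / norm v) *\<^sub>R v"
    have "?b \<in> B" using e assms(2) by (intro subsetD[OF e(2)]) (simp add: dist_norm)
    moreover have "a \<bullet> v < ?b \<bullet> v" using e(1) assms(2) by (simp add: inner_add_left)
    ultimately show False
      using a orth_proj_add_scaleR[OF assms(2), of a "e / norm v"]
      by (force simp: upper_graph_def)
  qed
  then show "a \<in> frontier B"
    using a assms(1) by (simp add: upper_graph_def frontier_def closure_closed compact_imp_closed)
qed

lemma upper_point_eq:
  assumes "compact B" "v \<noteq> 0" "a \<in> upper_graph B v"
  shows "upper_point B v (orth_proj v a) = a"
proof -
  have fB: "frontier B \<subseteq> B" by (simp add: assms compact_imp_closed frontier_subset_closed)
  have a: "a \<in> frontier B" "\<And>u. u \<in> B \<Longrightarrow> orth_proj v u = orth_proj v a \<Longrightarrow> u \<bullet> v \<le> a \<bullet> v"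
    using upper_graph_subset_frontier[OF assms(1,2)] assms(3) by (auto simp: upper_graph_def)
  show ?thesis
    unfolding upper_point_def
  proof (rule arg_maxI[where x = a])
    show "a \<in> frontier B \<and> orth_proj v a = orth_proj v a" using a by simp
    show "\<not> u \<bullet> v > a \<bullet> v" if "u \<in> frontier B \<and> orth_proj v u = orth_proj v a" for u
      using that a fB by (auto simp: not_less)
    fix u assume u: "u \<in> frontier B \<and> orth_proj v u = orth_proj v a"
      and max: "\<forall>y. y \<in> frontier B \<and> orth_proj v y = orth_proj v a \<longrightarrow> \<not> y \<bullet> v > u \<bullet> v"
    have "u \<bullet> v = a \<bullet> v" using u max a fB by (force simp: not_less intro: order_antisym)
    then show "u = a" using u by (auto intro: orth_proj_inner_inject)
  qed
qed

text \<open>Over the boundary of the shadow a fibre has a single point, since a second one would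
  produce an interior point of \<open>B\<close> in the fibre; so \<open>D_zero\<close> also consists of highest points.\<close>

lemma D_plus_eq_upper_graph:
  assumes "compact B" "strictly_convex B" "interior B \<noteq> {}" "v \<noteq> 0"
  shows "D_plus B v = upper_graph B v"
proof -
  note shadow = shadow_eq_interior_Un_boundary[OF assms(1,3,4)]
  have "D_zero B v \<subseteq> upper_graph B v"
  proof
    fix a assume a: "a \<in> D_zero B v"
    have "b = a" if "b \<in> B" "orth_proj v b = orth_proj v a" for b
    proof (rule ccontr)
      assume "b \<noteq> a"
      then have "midpoint a b \<in> interior B"
        using a that assms(2) by (intro strictly_convex_midpoint) (auto simp: D_zero_def)
      then have "orth_proj v a \<in> shadow_interior B v"
        using imageI[of "midpoint a b" "interior B" "orth_proj v"] orth_proj_midpoint[of v a b] that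
        by (simp add: shadow_interior_eq_image_interior assms)
      then show False using a shadow(2) by (auto simp: D_zero_def)
    qed
    then show "a \<in> upper_graph B v" using a by (auto simp: D_zero_def upper_graph_def)
  qed
  moreover have "upper_point B v x \<in> upper_graph B v" if "x \<in> shadow_interior B v" for x
  proof -
    obtain a where "a \<in> upper_graph B v" "orth_proj v a = x"
      using upper_graph_exists[OF assms(1)] shadow(1) \<open>x \<in> _\<close> by blast
    then show ?thesis using upper_point_eq[OF assms(1,4)] by metis
  qed
  moreover have "a \<in> D_plus B v" if a: "a \<in> upper_graph B v" for a
  proof (cases "orth_proj v a \<in> shadow_interior B v")
    case True
    then show ?thesis
      using upper_point_eq[OF assms(1,4) a] unfolding D_plus_def by (metis UnI2 imageI)
  next
    case False
    then show ?thesis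
      using a shadow(1) by (auto simp: D_plus_def D_zero_def upper_graph_def)
  qed
  ultimately show ?thesis by (auto simp: D_plus_def)
qed

text \<open>Reversing \<open>v\<close> exchanges highest and lowest points, so statements about \<open>D_plus\<close> transfer to
  \<open>D_minus\<close>.\<close>

lemma D_minus_eq_D_plus_uminus: "D_minus B v = D_plus B (- v)"
proof -
  have "perp (- v) = perp v" by (auto simp: perp_def)
  then show ?thesis
    by (simp add: fun_eq_iff D_minus_def D_plus_def D_zero_def shadow_interior_def
        shadow_boundary_def lower_point_def upper_point_def orth_proj_uminus arg_min_def arg_max_def
        is_arg_min_def is_arg_max_def)
qed

section \<open>The midpoint set\<close>

lemma midpoint_set_eq:
  assumes "compact B" "strictly_convex B" "interior B \<noteq> {}" "v \<noteq> 0"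
  shows "midpoint_set B v = {midpoint a b | a b. a \<in> upper_graph B v \<and> b \<in> upper_graph B (- v)
           \<and> orth_proj v a = orth_proj v b}"
  using assms by (simp add: midpoint_set_def D_minus_eq_D_plus_uminus D_plus_eq_upper_graph)

lemma compact_midpoint_set:
  assumes "compact B" "strictly_convex B" "interior B \<noteq> {}" "v \<noteq> 0"
  shows "compact (midpoint_set B v)"
proof -
  let ?R = "{z. orth_proj v (fst z) = orth_proj v (snd z)}"
  have "closed ?R"
    by (intro closed_Collect_eq continuous_on_compose2[OF continuous_on_orth_proj] continuous_intros)
      auto
  then have "compact ((upper_graph B v \<times> upper_graph B (- v)) \<inter> ?R)"
    using assms by (intro compact_Int_closed compact_Times compact_upper_graph) auto
  then have "compact ((\<lambda>z. midpoint (fst z) (snd z)) `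
               ((upper_graph B v \<times> upper_graph B (- v)) \<inter> ?R))"
    unfolding midpoint_def by (intro compact_continuous_image continuous_intros)
  moreover have "(\<lambda>z. midpoint (fst z) (snd z)) `
      ((upper_graph B v \<times> upper_graph B (- v)) \<inter> ?R) = midpoint_set B v"
    unfolding midpoint_set_eq[OF assms] by force
  ultimately show ?thesis by simp
qed

lemma inj_on_orth_proj_midpoint_set:
  assumes "compact B" "strictly_convex B" "interior B \<noteq> {}" "v \<noteq> 0"
  shows "inj_on (orth_proj v) (midpoint_set B v)"
proof (rule inj_onI)
  fix x y assume "x \<in> midpoint_set B v" "y \<in> midpoint_set B v" and xy: "orth_proj v x = orth_proj v y"
  then obtain a b c d where
    ab: "x = midpoint a b" "a \<in> upper_graph B v" "b \<in> upper_graph B (- v)"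
      "orth_proj v a = orth_proj v b" and
    cd: "y = midpoint c d" "c \<in> upper_graph B v" "d \<in> upper_graph B (- v)"
      "orth_proj v c = orth_proj v d"
    unfolding midpoint_set_eq[OF assms] by blast
  have eq: "orth_proj v a = orth_proj v c"
    using xy orth_proj_midpoint[OF ab(4)] orth_proj_midpoint[OF cd(4)] ab(1) cd(1) by simp
  then have "orth_proj (- v) b = orth_proj (- v) d"
    using ab(4) cd(4) by (simp add: orth_proj_uminus)
  then show "x = y" using eq ab cd by (metis upper_graph_unique)
qed

lemma orth_proj_image_midpoint_set:
  assumes "compact B" "strictly_convex B" "interior B \<noteq> {}" "v \<noteq> 0"
  shows "orth_proj v ` midpoint_set B v = orth_proj v ` B"
proof
  show "orth_proj v ` midpoint_set B v \<subseteq> orth_proj v ` B"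
    unfolding midpoint_set_eq[OF assms] by (auto simp: orth_proj_midpoint upper_graph_def)
  show "orth_proj v ` B \<subseteq> orth_proj v ` midpoint_set B v"
  proof
    fix x assume x: "x \<in> orth_proj v ` B"
    obtain a where a: "a \<in> upper_graph B v" "orth_proj v a = x"
      using upper_graph_exists[OF assms(1) x] .
    obtain b where b: "b \<in> upper_graph B (- v)" "orth_proj v b = x"
      using upper_graph_exists[OF assms(1), of x "- v"] x by (auto simp: orth_proj_uminus)
    have "midpoint a b \<in> midpoint_set B v"
      unfolding midpoint_set_eq[OF assms] mem_Collect_eq using a b by metis
    moreover have "orth_proj v (midpoint a b) = x" using a b by (simp add: orth_proj_midpoint)
    ultimately show "x \<in> orth_proj v ` midpoint_set B v" by blast
  qed
qed

lemma midpoint_set_subset: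
  assumes "compact B" "strictly_convex B" "interior B \<noteq> {}" "v \<noteq> 0"
  shows "midpoint_set B v \<subseteq> B"
proof
  fix x assume "x \<in> midpoint_set B v"
  then obtain a b where ab: "x = midpoint a b" "a \<in> B" "b \<in> B"
    unfolding midpoint_set_eq[OF assms] upper_graph_def by blast
  then show "x \<in> B"
    using strictly_convex_midpoint[OF assms(2), of a b] interior_subset[of B]
    by (cases "a = b") auto
qed

text \<open>Over an interior point of the shadow the fibre contains an interior point of \<open>B\<close>, which is
  neither highest nor lowest; so the two extreme points differ and their midpoint is interior.
  Conversely, an interior point of \<open>B\<close> never lies over the boundary of the shadow.\<close>

lemma midpoint_in_frontier_iff:
  assumes "compact B" "strictly_convex B" "interior B \<noteq> {}" "v \<noteq> 0"
    and x: "x \<in> midpoint_set B v"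
  shows "x \<in> frontier B \<longleftrightarrow> orth_proj v x \<in> shadow_boundary B v"
proof -
  note shadow = shadow_eq_interior_Un_boundary[OF assms(1,3,4)]
  note int = shadow_interior_eq_image_interior[OF assms(2-4)]
  have xB: "x \<in> B" using midpoint_set_subset[OF assms(1-4)] x by blast
  have "x \<in> interior B" if "orth_proj v x \<in> shadow_interior B v"
  proof -
    obtain a b where ab: "x = midpoint a b" "a \<in> upper_graph B v" "b \<in> upper_graph B (- v)"
      "orth_proj v a = orth_proj v b"
      using x unfolding midpoint_set_eq[OF assms(1-4)] by blast
    have "orth_proj v a \<in> orth_proj v ` interior B"
      using that orth_proj_midpoint[OF ab(4)] by (simp add: int ab(1))
    then obtain c where c: "c \<in> interior B" "orth_proj v c = orth_proj v a"
      by (elim imageE) simp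
    have "c \<in> B" using c(1) interior_subset by blast
    have "a \<noteq> b"
    proof
      assume "a = b"
      \<comment> \<open>A point that is both highest and lowest is the whole fibre.\<close>
      then have "c \<bullet> v = a \<bullet> v"
        using ab(2,3) c(2) \<open>c \<in> B\<close>
        by (intro order_antisym) (simp_all add: upper_graph_def orth_proj_uminus)
      with c(2) have "c = a" by (rule orth_proj_inner_inject)
      then show False
        using upper_graph_subset_frontier[OF assms(1,4)] ab(2) c(1) by (auto simp: frontier_def)
    qed
    moreover have "a \<in> B" "b \<in> B" using ab(2,3) by (simp_all add: upper_graph_def)
    ultimately show ?thesis using strictly_convex_midpoint[OF assms(2)] ab(1) by simp
  qed
  moreover have "orth_proj v x \<in> shadow_interior B v" if "x \<in> interior B"
    using that by (simp add: int)
  moreover have "x \<in> frontier B \<longleftrightarrow> x \<notin> interior B"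
    using xB closure_subset[of B] by (auto simp: frontier_def)
  ultimately show ?thesis using shadow xB by blast
qed

text \<open>Since \<open>p\<close> carries the midpoint set and its part on \<open>frontier B\<close> to the shadow and its relative
  frontier, it only remains to compare the shadow with the disc: compact convex sets of equal
  affine dimension are homeomorphic, and so are their relative frontiers.\<close>

theorem proposition1p2:
  fixes B :: "(real ^ 'm) set" and v :: "real ^ 'm"
  assumes "CARD('m::finite) = CARD('n::finite) + 1"
    and "compact B"
    and "strictly_convex B"
    and "interior B \<noteq> {}"
    and "v \<noteq> 0"
  shows "midpoint_set B v homeomorphic (cball 0 1 :: (real ^ 'n) set)
       \<and> (midpoint_set B v \<inter> frontier B) homeomorphic (sphere 0 1 :: (real ^ 'n) set)"
proof -
  let ?M = "midpoint_set B v" and ?P = "orth_proj v ` B" and ?D = "cball 0 1 :: (real ^ 'n) set"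
  obtain q where q: "homeomorphism ?M ?P (orth_proj v) q"
    using homeomorphism_compact[OF compact_midpoint_set continuous_on_orth_proj
        orth_proj_image_midpoint_set inj_on_orth_proj_midpoint_set] assms by blast
  have "orth_proj v ` (?M \<inter> frontier B) = rel_frontier ?P"
  proof -
    have "orth_proj v ` (?M \<inter> frontier B) = orth_proj v ` ?M \<inter> shadow_boundary B v"
      using midpoint_in_frontier_iff[OF assms(2-5)] by blast
    also have "\<dots> = shadow_boundary B v"
      using orth_proj_image_midpoint_set[OF assms(2-5)]
        shadow_eq_interior_Un_boundary(1)[OF assms(2,4,5)] by blast
    finally show ?thesis by (simp add: shadow_boundary_eq_rel_frontier assms)
  qed
  then have "homeomorphism (?M \<inter> frontier B) (rel_frontier ?P) (orth_proj v) q"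
    by (intro homeomorphism_of_subsets[OF q]) auto
  then have frontier: "?M \<inter> frontier B homeomorphic rel_frontier ?P"
    by (auto simp: homeomorphic_def)
  have P: "convex ?P" "compact ?P"
    using assms by (auto intro: convex_linear_image linear_orth_proj strictly_convex_imp_convex
        compact_continuous_image continuous_on_orth_proj)
  have "aff_dim ?P = aff_dim (perp v)"
    using affine_hull_shadow[OF assms(4,5)] by (metis aff_dim_affine_hull)
  also have "\<dots> = int CARD('n)"
    using aff_dim_hyperplane[OF assms(5), of 0] assms(1) by (simp add: perp_def)
  also have "\<dots> = aff_dim ?D" by (simp add: aff_dim_cball)
  finally have dim: "aff_dim ?P = aff_dim ?D" .
  have "?P homeomorphic ?D"
    using P dim by (intro homeomorphic_convex_compact_sets) auto
  moreover have "rel_frontier ?P homeomorphic rel_frontier ?D"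
    using P dim by (intro homeomorphic_rel_frontiers_convex_bounded_sets) (auto intro: compact_imp_bounded)
  moreover have "rel_frontier ?D = sphere 0 1" by (simp add: rel_frontier_cball)
  ultimately show ?thesis
    using q frontier by (metis homeomorphic_def homeomorphic_trans)
qed

end
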